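(* Let $n\ge 2$. For any permutations $w,v\in S_n$, $$w\star v \;=\; h_{n-1,\,w_{\nwarrow n-1}}\circ h_{n-2,\,w_{\nwarrow n-2}}\circ\cdots\circ h_{2,\,w_{\nwarrow 2}}\circ h_{1,\,w_{\nwarrow 1}}\,(wv),$$ where $wv$ is the usual product, and the hopping operators are applied in the order $h_{1,\cdot}$ first, then $h_{2,\cdot}$, and so on up to $h_{n-1,\cdot}$.
   Context: $S_n$ is the symmetric group on $[n]=\{1,\dots,n\}$, with permutations written in one-line notation $w=w(1)w(2)\cdots w(n)$. Products are compositions, $(wv)(k)=w(v(k))$; thus left multiplication by $u$ replaces each entry $x$ of the one-line notation by $u(x)$. Let $s_i$ be the transposition $(i,i+1)$ for $1\le i\le n-1$ (the Coxeter generators), and let $\ell$ denote Coxeter length (the number of inversions). The Demazure product $\star$ on $S_n$ is the associative product determined by the following two rules: - $s_i\star u=u$ if $\ell(s_iu)<\ell(u)$, and $s_i\star u=s_iu$ otherwise; - $w\star u=s_{a_1}\star(s_{a_2}\star(\cdots\star(s_{a_k}\star u)))$ for any reduced word $w=s_{a_1}\cdots s_{a_k}$. Equivalently, $\star$ is the product of the monoid generated by the $s_i$ subject to the braid relations and $s_i\star s_i=s_i$. Hopping operator: let $t\in[n]$ and let $L$ be an ordered list of distinct elements of $[n]$. The map $h_{t,L}:S_n\to S_n$ acts on $w$ by the following iteration. - Consider the entries of the one-line notation of $w$ that lie to the right of $t$, belong to $L$, and are greater than $t$. - If there are none, output $w$. - Otherwise, let $q$ be the one among them that occurs latest in the ordered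 list $L$. Swap the positions of $t$ and $q$ in $w$, replace $w$ by the result, and repeat. For $w\in S_n$ and $a\in[n]$, $w_{\nwarrow a}$ denotes the ordered list obtained as follows: take the entries of the one-line notation of $w$ lying strictly to the left of the entry $a$, keep only those greater than $a$, and keep them in their order of appearance. *)

theory Defs
  imports Main "HOL-Combinatorics.Permutations" "HOL-Library.While_Combinator"
begin

text \<open>
  Elements of $S_n$ are functions \<open>w :: nat \<Rightarrow> nat\<close> with \<open>w permutes {1..n}\<close>;
  the product \<open>w v\<close> is \<open>w \<circ> v\<close>, and the position of the entry \<open>x\<close> in the one-line
  notation of \<open>w\<close> is \<open>inv w x\<close>.
\<close>

definition coxeter_gen :: "nat \<Rightarrow> nat \<Rightarrow> nat" where
  "coxeter_gen i = transpose i (i + 1)"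

definition coxeter_length :: "nat \<Rightarrow> (nat \<Rightarrow> nat) \<Rightarrow> nat" where
  "coxeter_length n w = card {(i, j). 1 \<le> i \<and> i < j \<and> j \<le> n \<and> w j < w i}"

definition reduced_word :: "nat \<Rightarrow> (nat \<Rightarrow> nat) \<Rightarrow> nat list \<Rightarrow> bool" where
  "reduced_word n w as \<longleftrightarrow>
     set as \<subseteq> {1..n - 1} \<and>
     w = foldr (\<lambda>i u. coxeter_gen i \<circ> u) as id \<and>
     length as = coxeter_length n w"

definition demazure_gen :: "nat \<Rightarrow> nat \<Rightarrow> (nat \<Rightarrow> nat) \<Rightarrow> (nat \<Rightarrow> nat)" where
  "demazure_gen n i u =
     (if coxeter_length n (coxeter_gen i \<circ> u) < coxeter_length n u
      then u else coxeter_gen i \<circ> u)"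

text \<open>
  The value is the one obtained from every reduced word of \<open>w\<close>; the definite description
  makes independence of the reduced word part of what has to be proved about it.
\<close>

definition demazure_product :: "nat \<Rightarrow> (nat \<Rightarrow> nat) \<Rightarrow> (nat \<Rightarrow> nat) \<Rightarrow> (nat \<Rightarrow> nat)" where
  "demazure_product n w u =
     (THE x. \<forall>as. reduced_word n w as \<longrightarrow> x = foldr (demazure_gen n) as u)"

text \<open>
  \<open>hop_candidates t L w\<close> is listed in the order of \<open>L\<close>, so its last element is the
  candidate occurring latest in \<open>L\<close>. Swapping the positions of the entries \<open>t\<close> and \<open>q\<close>
  is left multiplication by the transposition of \<open>t\<close> and \<open>q\<close>. On permutations of
  \<open>{1..n}\<close> with \<open>set L \<subseteq> {1..n}\<close> the loop terminates, since the position of \<open>t\<close> increases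
  in every iteration.
\<close>

definition hop_candidates :: "nat \<Rightarrow> nat list \<Rightarrow> (nat \<Rightarrow> nat) \<Rightarrow> nat list" where
  "hop_candidates t L w = filter (\<lambda>q. inv w t < inv w q \<and> t < q) L"

definition hop :: "nat \<Rightarrow> nat list \<Rightarrow> (nat \<Rightarrow> nat) \<Rightarrow> (nat \<Rightarrow> nat)" where
  "hop t L = while (\<lambda>w. hop_candidates t L w \<noteq> [])
                   (\<lambda>w. transpose t (last (hop_candidates t L w)) \<circ> w)"

definition left_greater :: "(nat \<Rightarrow> nat) \<Rightarrow> nat \<Rightarrow> nat list" where
  "left_greater w a = filter (\<lambda>x. a < x) (map w [1..<inv w a])"

end

theory Submission imports Defs begin

text \<open>
  Write \<open>H w v\<close> for the right-hand side of the theorem. If \<open>u s\<^sub>i\<close> is longer than \<open>u\<close>, then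
  \<open>H (u s\<^sub>i) v = H u (s\<^sub>i \<star> v)\<close>; peeling letters off the right end of any reduced word of \<open>w\<close> then
  gives the theorem. Put \<open>a = u i < b = u (i + 1)\<close> and run the hops for \<open>u s\<^sub>i\<close> and for \<open>u\<close> side by side.
  As long as \<open>t < a\<close>, the two hopping lists differ by exchanging the neighbours \<open>a, b\<close>, and the two
  current permutations are equal or differ by exchanging the values \<open>a\<close> and \<open>b\<close>, with \<open>b\<close> left of \<open>a\<close>
  in the run for \<open>u\<close>. At \<open>t = a\<close> the list for \<open>u s\<^sub>i\<close> has the additional last element \<open>b\<close>, whose hop
  undoes the exchange if there was one. For \<open>t > a\<close> the lists agree.
\<close>

section \<open>Hopping\<close>

lemma inv_transpose_comp:
  assumes "x permutes S"
  shows "inv (transpose a b \<circ> x) y = inv x (transpose a b y)"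
  using o_inv_distrib[of "transpose a b" x] permutes_bij[OF assms] by simp

lemma hop_Nil: "hop_candidates t L x = [] \<Longrightarrow> hop t L x = x"
  unfolding hop_def by (subst while_unfold) simp

lemma hop_step:
  "hop_candidates t L x \<noteq> [] \<Longrightarrow>
    hop t L x = hop t L (transpose t (last (hop_candidates t L x)) \<circ> x)"
  unfolding hop_def by (subst while_unfold) simp

lemma permutes_transpose_comp:
  "x permutes S \<Longrightarrow> a \<in> S \<Longrightarrow> b \<in> S \<Longrightarrow> transpose a b \<circ> x permutes S"
  by (simp add: permutes_compose permutes_swap_id)

text \<open>A hop carries \<open>t\<close> to the position of \<open>q\<close>, strictly to the
  right and still at most \<open>n\<close>, so \<open>n - inv x t\<close> decreases. This is the
  termination argument for \<open>while\<close>, packaged as induction along the run.\<close>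

lemma hop_induct [consumes 3, case_names stop step]:
  assumes "x permutes {1..n}" "t \<in> {1..n}" "set L \<subseteq> {1..n}"
    and stop: "\<And>x. x permutes {1..n} \<Longrightarrow> hop_candidates t L x = [] \<Longrightarrow> P x"
    and step: "\<And>x q y. x permutes {1..n} \<Longrightarrow> hop_candidates t L x \<noteq> [] \<Longrightarrow>
      last (hop_candidates t L x) = q \<Longrightarrow> q \<in> set L \<Longrightarrow> inv x t < inv x q \<Longrightarrow> t < q \<Longrightarrow>
      y = transpose t q \<circ> x \<Longrightarrow> hop t L x = hop t L y \<Longrightarrow> y permutes {1..n} \<Longrightarrow> P y \<Longrightarrow> P x"
  shows "P x"
  using assms(1)
proof (induction "n - inv x t" arbitrary: x rule: less_induct)
  case less
  show ?case
  proof (cases "hop_candidates t L x = []")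
    case True
    then show ?thesis using stop less.prems by blast
  next
    case False
    define q where "q = last (hop_candidates t L x)"
    have "q \<in> set (hop_candidates t L x)"
      using False by (simp add: q_def)
    then have q: "q \<in> set L" "inv x t < inv x q" "t < q"
      by (auto simp: hop_candidates_def)
    let ?y = "transpose t q \<circ> x"
    have y: "?y permutes {1..n}"
      using less.prems assms(2,3) q by (intro permutes_transpose_comp) auto
    have "inv x q \<in> {1..n}"
      using permutes_in_image[OF permutes_inv[OF less.prems]] q(1) assms(3) by auto
    moreover have "inv ?y t = inv x q"
      using inv_transpose_comp[OF less.prems] by simp
    ultimately have "n - inv ?y t < n - inv x t"
      using q(2) by auto
    then show ?thesis
      using less.hyps[of ?y] y step[OF less.prems False q_def[symmetric] q refl] hop_step[OF False]
      by (simp only: q_def)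
  qed
qed

lemma hop_permutes:
  assumes "x permutes {1..n}" "t \<in> {1..n}" "set L \<subseteq> {1..n}"
  shows "hop t L x permutes {1..n}"
  using assms
proof (induction rule: hop_induct)
  case (stop x)
  then show ?case by (simp add: hop_Nil)
next
  case (step x q y)
  then show ?case by (simp only:)
qed

text \<open>The transposition fixes \<open>t\<close>, and \<open>a\<close>, \<open>b\<close> both
  exceed \<open>t\<close>. Relabelling therefore preserves candidacy and list order, and the two
  runs correspond hop by hop.\<close>

lemma hop_relabel:
  assumes "x permutes {1..n}" "t \<in> {1..n}" "set L \<subseteq> {1..n}"
    and "t < a" "t < b"
  shows "hop t (map (transpose a b) L) (transpose a b \<circ> x) = transpose a b \<circ> hop t L x"
proof -
  let ?\<tau> = "transpose a b"
  have \<tau>: "t < ?\<tau> q \<longleftrightarrow> t < q" "?\<tau> t = t" for q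
    using assms(4,5) by (auto simp: transpose_def)
  have cands: "hop_candidates t (map ?\<tau> L) (?\<tau> \<circ> x) = map ?\<tau> (hop_candidates t L x)"
    if "x permutes {1..n}" for x
    by (simp add: hop_candidates_def filter_map o_def inv_transpose_comp[OF that, unfolded o_def] \<tau>)
  show ?thesis
    using assms(1-3)
  proof (induction rule: hop_induct)
    case (stop x)
    then have "hop_candidates t (map ?\<tau> L) (?\<tau> \<circ> x) = []" using cands by simp
    then show ?case using stop(2) by (simp only: hop_Nil)
  next
    case (step x q y)
    have c: "hop_candidates t (map ?\<tau> L) (?\<tau> \<circ> x) \<noteq> []"
      "last (hop_candidates t (map ?\<tau> L) (?\<tau> \<circ> x)) = ?\<tau> q"
      using step(2,3) by (simp_all add: cands[OF step(1)] last_map)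
    have "transpose t (?\<tau> q) \<circ> (?\<tau> \<circ> x) = ?\<tau> \<circ> y"
      using assms(4,5) unfolding step(7) by (auto simp: fun_eq_iff transpose_def)
    then have "hop t (map ?\<tau> L) (?\<tau> \<circ> x) = hop t (map ?\<tau> L) (?\<tau> \<circ> y)"
      using hop_step[OF c(1)] c(2) by (simp only:)
    then show ?case
      using step(8,10) by (simp only:)
  qed
qed

text \<open>The shape of the hopping lists for \<open>t < a\<close> in the run for \<open>u\<close>.\<close>

definition swappable :: "nat \<Rightarrow> nat \<Rightarrow> nat list \<Rightarrow> bool" where
  "swappable a b L \<longleftrightarrow> {a, b} \<inter> set L = {} \<or>
     (\<exists>A B. L = A @ [a, b] @ B \<and> {a, b} \<inter> (set A \<union> set B) = {})"

lemma map_transpose_id: "{a, b} \<inter> set L = {} \<Longrightarrow> map (transpose a b) L = L"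
  by (induction L) (auto simp: transpose_def)

text \<open>The next hop depends on the order of \<open>a\<close> and \<open>b\<close> in the list
  only if both are candidates and nothing after them is. This is \<open>both\<close>:
  \<open>L\<close> picks \<open>b\<close> and then \<open>a\<close>, the exchanged list picks
  \<open>a\<close> at once. In \<open>same\<close>, the condition on \<open>q = a\<close> ensures
  that \<open>a\<close>, landing on the old position of \<open>t\<close>, stays right of
  \<open>b\<close>.\<close>

lemma swappable_cases:
  assumes "swappable a b L" "x permutes S" "inv x b < inv x a" "t < a" "t < b"
    and ne: "hop_candidates t L x \<noteq> []"
    and q: "last (hop_candidates t L x) = q"
  obtains (same) "q \<noteq> b" "q = a \<Longrightarrow> inv x b < inv x t"
      "hop_candidates t (map (transpose a b) L) x \<noteq> []"
      "last (hop_candidates t (map (transpose a b) L) x) = q"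
  | (both) "q = b" "inv x t < inv x b"
      "hop_candidates t (map (transpose a b) L) x \<noteq> []"
      "last (hop_candidates t (map (transpose a b) L) x) = a"
      "hop_candidates t L (transpose t b \<circ> x) \<noteq> []"
      "last (hop_candidates t L (transpose t b \<circ> x)) = a"
proof -
  let ?\<tau> = "transpose a b"
  have "{a, b} \<inter> set L = {} \<or> (\<exists>A B. L = A @ [a, b] @ B \<and> {a, b} \<inter> (set A \<union> set B) = {})"
    using assms(1) by (simp add: swappable_def)
  then show thesis
  proof (elim disjE exE conjE)
    assume L: "{a, b} \<inter> set L = {}"
    have "q \<in> set (hop_candidates t L x)" using ne q by auto
    then have "q \<in> set L" by (simp add: hop_candidates_def)
    then have "q \<noteq> a" "q \<noteq> b" using L by auto
    then show thesis
      using that(1) ne q map_transpose_id[OF L] by simp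
  next
    fix A B
    assume L: "L = A @ [a, b] @ B" and ab: "{a, b} \<inter> (set A \<union> set B) = {}"
    have \<tau>L: "map ?\<tau> L = A @ [b, a] @ B"
      using map_transpose_id[of a b A] map_transpose_id[of a b B] ab L by auto
    let ?c = "\<lambda>L. hop_candidates t L x"
    have app: "hop_candidates t (M @ N) y = hop_candidates t M y @ hop_candidates t N y" for M N y
      by (simp add: hop_candidates_def)
    have ins: "set (hop_candidates t M y) \<subseteq> set M" for M y
      by (auto simp: hop_candidates_def)
    have neq: "inv x b \<noteq> inv x t"
      using permutes_inj[OF permutes_inv[OF assms(2)]] assms(5) by (auto simp: inj_eq)
    \<comment> \<open>A candidate in \<open>B\<close> wins in either list. Otherwise, as
      \<open>b\<close> is left of \<open>a\<close>, the position of \<open>t\<close> relative to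
      these two decides which of them are candidates.\<close>
    consider (B) "?c B \<noteq> []" | (both') "?c B = []" "inv x t < inv x b"
      | (a) "?c B = []" "inv x b < inv x t" "inv x t < inv x a"
      | (A) "?c B = []" "inv x a \<le> inv x t"
      using assms(3) neq by linarith
    then show thesis
    proof cases
      case B
      then have "q = last (?c B)" using q L by (simp only: app last_append) simp
      then have "q \<in> set B" using B ins[of B x] last_in_set[of "?c B"] by blast
      then have "q \<noteq> a" "q \<noteq> b" using ab by auto
      then show thesis using that(1) B \<tau>L \<open>q = last (?c B)\<close>
        by (simp only: app last_append) simp
    next
      case both'
      have ab2: "?c [a, b] = [a, b]" "?c [b, a] = [b, a]"
        using both' assms by (auto simp: hop_candidates_def)
      have "a \<noteq> b" using assms(3) by auto
      \<comment> \<open>The hop over \<open>b\<close> only moves \<open>t\<close> to the right, so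
        no entry of \<open>B\<close> becomes a candidate.\<close>
      have B': "hop_candidates t B (transpose t b \<circ> x) = []"
        using both' ab
        by (auto simp: hop_candidates_def filter_empty_conv inv_transpose_comp[OF assms(2)] transpose_def)
      have a': "hop_candidates t [a, b] (transpose t b \<circ> x) = [a]"
        using both' assms \<open>a \<noteq> b\<close>
        by (auto simp: hop_candidates_def inv_transpose_comp[OF assms(2)] transpose_def)
      have "q = b" using q unfolding L app ab2 both'(1) by simp
      then show thesis
        by (rule that(2)) (simp_all only: both'(2) \<tau>L, simp_all only: L app ab2 both'(1) B' a', simp_all)
    next
      case a
      have ab2: "?c [a, b] = [a]" "?c [b, a] = [a]"
        using a assms by (auto simp: hop_candidates_def)
      have "a \<noteq> b" using assms(3) by auto
      have "q = a" using q unfolding L app ab2 a(1) by simp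
      then show thesis
        using \<open>a \<noteq> b\<close>
        by (intro that(1)) (simp_all only: a(2) \<tau>L app ab2 a(1), simp_all)
    next
      case A
      have ab2: "?c [a, b] = []" "?c [b, a] = []"
        using A assms by (auto simp: hop_candidates_def)
      have c: "?c L = ?c A" "?c (map ?\<tau> L) = ?c A"
        unfolding \<tau>L by (simp_all only: L app ab2 A(1)) simp_all
      then have "q \<in> set A" using q ne ins[of A x] last_in_set[of "?c A"] by auto
      then have "q \<noteq> a" "q \<noteq> b" using ab by auto
      then show thesis using that(1) c ne q by simp
    qed
  qed
qed

lemma swappable_Nil:
  assumes "swappable a b L" "hop_candidates t L x = []"
  shows "hop_candidates t (map (transpose a b) L) x = []"
proof -
  have "set (map (transpose a b) L) = set L"
    using assms(1)
  proof (unfold swappable_def, elim disjE exE conjE)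
    assume "{a, b} \<inter> set L = {}"
    then show ?thesis by (simp add: map_transpose_id del: set_map)
  next
    fix A B
    assume "L = A @ [a, b] @ B" "{a, b} \<inter> (set A \<union> set B) = {}"
    then show ?thesis
      using map_transpose_id[of a b A] map_transpose_id[of a b B] by (auto simp del: set_map)
  qed
  then show ?thesis
    using assms(2) by (simp add: hop_candidates_def filter_empty_conv)
qed

text \<open>A hop moves \<open>q\<close> to the left and no other entry except \<open>t\<close>, so
  the order could only break when \<open>a\<close> is hopped over while \<open>t\<close> is left of
  \<open>b\<close>. But then \<open>b\<close> is a candidate standing after \<open>a\<close> in the
  list, and is chosen first.\<close>

lemma hop_keeps_order:
  assumes "x permutes {1..n}" "t \<in> {1..n}" "set L \<subseteq> {1..n}"
    and "swappable a b L" "t < a" "t < b" "inv x b < inv x a"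
  shows "inv (hop t L x) b < inv (hop t L x) a"
  using assms(1-3,7)
proof (induction rule: hop_induct)
  case (stop x)
  then show ?case by (simp add: hop_Nil)
next
  case (step x q y)
  have "inv y b < inv y a"
    using assms(4) step(1,11) assms(5,6) step(2,3) unfolding step(7)
    by (cases rule: swappable_cases)
      (use assms(5,6) step(1-6,11) in \<open>auto simp: inv_transpose_comp transpose_def\<close>)
  then show ?case
    using step(8,10) by simp
qed

text \<open>The invariant of the side-by-side comparison: \<open>y\<close> is the state of the run
  with the exchanged lists, \<open>x\<close> that of the original run. The order of \<open>a\<close>
  and \<open>b\<close> is prescribed in \<open>x\<close> only.\<close>

definition coupled :: "nat \<Rightarrow> nat \<Rightarrow> (nat \<Rightarrow> nat) \<Rightarrow> (nat \<Rightarrow> nat) \<Rightarrow> bool" where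
  "coupled a b y x \<longleftrightarrow> inv x b < inv x a \<and> (y = x \<or> y = transpose a b \<circ> x)"

text \<open>The two runs make the same hops unless \<open>both\<close> occurs. From then on they are
  relabellings of each other by \<open>hop_relabel\<close>, and \<open>hop_keeps_order\<close> gives
  the order at the end.\<close>

lemma hop_coupled_refl:
  assumes "x permutes {1..n}" "t \<in> {1..n}" "set L \<subseteq> {1..n}"
    and "swappable a b L" "t < a" "t < b" "a \<in> {1..n}" "b \<in> {1..n}" "inv x b < inv x a"
  shows "coupled a b (hop t (map (transpose a b) L) x) (hop t L x)"
  using assms(1-3,9)
proof (induction rule: hop_induct)
  case (stop x)
  then show ?case
    using swappable_Nil[OF assms(4)] by (simp add: hop_Nil coupled_def)
next
  case (step x q y)
  note [simp] = inv_transpose_comp[OF step(1)]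
  from assms(4) step(1,11) assms(5,6) step(2,3) show ?case
  proof (cases rule: swappable_cases)
    case same
    have "inv y b < inv y a"
      using same step(1-6,11) assms(5,6) unfolding step(7) by (auto simp: transpose_def)
    moreover have "hop t (map (transpose a b) L) x = hop t (map (transpose a b) L) y"
      using hop_step[OF same(3)] same(4) step(7) by (simp only:)
    ultimately show ?thesis
      using step(8,10) by simp
  next
    case both
    \<comment> \<open>Two hops, over \<open>b\<close> and then \<open>a\<close>, correspond to the single hop over \<open>a\<close> in the exchanged list.\<close>
    let ?z = "transpose t a \<circ> (transpose t b \<circ> x)"
    have tb: "transpose t b \<circ> x permutes {1..n}"
      using step(7,9) both(1) by (simp only:)
    have z: "?z permutes {1..n}"
      by (rule permutes_transpose_comp[OF tb assms(2,7)])
    have L: "hop t L x = hop t L ?z"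
      using step(8) hop_step[OF both(5)] unfolding step(7) both(1,6) by (simp only:)
    have ne: "t \<noteq> a" "t \<noteq> b" "a \<noteq> b"
      using step(11) assms(5,6) by auto
    \<comment> \<open>The identity (t a) = (a b)(t a)(t b).\<close>
    have "transpose t a \<circ> x = transpose a b \<circ> ?z"
      using ne by (auto simp: fun_eq_iff transpose_def)
    then have "hop t (map (transpose a b) L) x = transpose a b \<circ> hop t L ?z"
      using both(4) hop_step[OF both(3)] hop_relabel[OF z assms(2,3,5,6)] by (simp only:)
    moreover have "inv ?z b < inv ?z a"
      using both step(11) ne by (simp add: inv_transpose_comp[OF tb] transpose_def)
    then have "inv (hop t L ?z) b < inv (hop t L ?z) a"
      using hop_keeps_order z assms by blast
    ultimately show ?thesis
      unfolding coupled_def L by blast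
  qed
qed

lemma hop_coupled:
  assumes "x permutes {1..n}" "t \<in> {1..n}" "set L \<subseteq> {1..n}"
    and "swappable a b L" "t < a" "t < b" "a \<in> {1..n}" "b \<in> {1..n}" "coupled a b y x"
  shows "coupled a b (hop t (map (transpose a b) L) y) (hop t L x)"
  using assms hop_coupled_refl[OF assms(1-8)] hop_keeps_order[OF assms(1-6)]
    hop_relabel[OF assms(1-3,5,6)]
  by (auto simp: coupled_def)

text \<open>From \<open>x\<close>, the extra \<open>b\<close> is never a candidate: it starts left
  of \<open>a\<close>, and \<open>a\<close> only moves right. From
  \<open>transpose a b \<circ> x\<close>, it is the last candidate, and the hop over it yields
  \<open>x\<close>.\<close>

lemma hop_snoc_coupled:
  assumes "x permutes {1..n}" "a \<in> {1..n}" "set L \<subseteq> {1..n}"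
    and "a < b" "b \<notin> set L" "coupled a b y x"
  shows "hop a (L @ [b]) y = hop a L x"
proof -
  have x: "inv x b < inv x a" and y: "y = x \<or> y = transpose a b \<circ> x"
    using assms(6) by (auto simp: coupled_def)
  have eq: "hop a (L @ [b]) x = hop a L x"
    using assms(1-3) x
  proof (induction rule: hop_induct)
    case (stop x)
    then have "hop_candidates a (L @ [b]) x = []"
      by (simp add: hop_candidates_def)
    then show ?case using stop by (simp add: hop_Nil)
  next
    case (step x q y)
    have c: "hop_candidates a (L @ [b]) x = hop_candidates a L x"
      using step(11) by (simp add: hop_candidates_def)
    have "inv y b < inv y a"
      using step(1-6,11) assms(4,5) unfolding step(7) by (auto simp: inv_transpose_comp[OF step(1)] transpose_def)
    moreover have "hop a (L @ [b]) x = hop a (L @ [b]) y"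
      using hop_step[of a "L @ [b]" x] step(2,3,7) c by (simp only: not_False_eq_True)
    ultimately show ?case
      using step(8,10) by simp
  qed
  have "hop a (L @ [b]) (transpose a b \<circ> x) = hop a (L @ [b]) x"
  proof -
    have c: "last (hop_candidates a (L @ [b]) (transpose a b \<circ> x)) = b"
      "hop_candidates a (L @ [b]) (transpose a b \<circ> x) \<noteq> []"
      using x assms(4) by (simp_all add: hop_candidates_def inv_transpose_comp[OF assms(1)])
    have "transpose a b \<circ> (transpose a b \<circ> x) = x"
      by (simp add: fun_eq_iff)
    then show ?thesis
      using hop_step[OF c(2)] c(1) by simp
  qed
  then show ?thesis
    using y eq by auto
qed

section \<open>The lists of larger entries to the left\<close>

lemma left_greater_subset:
  assumes "w permutes {1..n}" "t \<in> {1..n}"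
  shows "set (left_greater w t) \<subseteq> {1..n}"
proof -
  have "inv w t \<in> {1..n}"
    using permutes_in_image[OF permutes_inv[OF assms(1)]] assms(2) by blast
  then show ?thesis
    using permutes_in_image[OF assms(1)] by (force simp: left_greater_def)
qed

lemma coxeter_gen_simps [simp]:
  "coxeter_gen i i = Suc i" "coxeter_gen i (Suc i) = i"
  "j \<noteq> i \<Longrightarrow> j \<noteq> Suc i \<Longrightarrow> coxeter_gen i j = j"
  "coxeter_gen i (coxeter_gen i j) = j"
  "coxeter_gen i \<circ> coxeter_gen i = id"
  by (auto simp: coxeter_gen_def transpose_def)

context
  fixes n i :: nat and u :: "nat \<Rightarrow> nat"
  assumes u: "u permutes {1..n}" and i: "1 \<le> i" "Suc i \<le> n" and asc: "u i < u (Suc i)"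
begin

lemma comp_gen_eq: "u \<circ> coxeter_gen i = transpose (u i) (u (Suc i)) \<circ> u"
  using permutes_inj[OF u] by (auto simp: fun_eq_iff coxeter_gen_def transpose_def inj_eq)

lemma inv_comp_gen: "inv (u \<circ> coxeter_gen i) t = coxeter_gen i (inv u t)"
  using o_inv_distrib[of u "coxeter_gen i"] permutes_bij[OF u] by (simp add: coxeter_gen_def)

lemma inv_u [simp]: "inv u (u j) = j"
  using permutes_inverses(2)[OF u] .

lemma inv_u_neq: "t \<noteq> u j \<Longrightarrow> inv u t \<noteq> j"
  using permutes_inverses(1)[OF u] by metis

lemma upt_split: "i + 2 \<le> p \<Longrightarrow> [1..<p] = [1..<i] @ [i, Suc i] @ [i + 2..<p]"
proof -
  assume "i + 2 \<le> p"
  then have "[1..<p] = [1..<i] @ [i..<p]" "[i..<p] = i # Suc i # [i + 2..<p]"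
    using i upt_add_eq_append[of 1 i "p - i"] upt_conv_Cons[of i p] upt_conv_Cons[of "Suc i" p]
    by simp_all
  then show ?thesis by simp
qed

lemma map_comp_gen: "i \<notin> set js \<Longrightarrow> Suc i \<notin> set js \<Longrightarrow> map (u \<circ> coxeter_gen i) js = map u js"
  by (induction js) auto

lemma position_cases:
  assumes "t \<noteq> u i" "t \<noteq> u (Suc i)"
  obtains "inv u t < i" "inv (u \<circ> coxeter_gen i) t = inv u t"
  | "i + 2 \<le> inv u t" "inv (u \<circ> coxeter_gen i) t = inv u t"
proof -
  have "inv u t \<noteq> i" "inv u t \<noteq> Suc i" using inv_u_neq assms by auto
  then show thesis using that by (simp add: inv_comp_gen) linarith
qed

text \<open>The entry \<open>t\<close> has the same position in both words, before both of
  \<open>i\<close>, \<open>i + 1\<close> or after both. So its list contains neither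
  \<open>u i\<close> nor \<open>u (i + 1)\<close>, or both as neighbours; both exceed
  \<open>t\<close>, hence survive the filter.\<close>

lemma left_greater_below:
  assumes "t < u i"
  shows "left_greater (u \<circ> coxeter_gen i) t = map (transpose (u i) (u (Suc i))) (left_greater u t)"
    and "swappable (u i) (u (Suc i)) (left_greater u t)"
proof -
  let ?\<tau> = "transpose (u i) (u (Suc i))"
  have tn: "t \<noteq> u i" "t \<noteq> u (Suc i)" using assms asc by auto
  then have inv: "inv (u \<circ> coxeter_gen i) t = inv u t"
    by (cases rule: position_cases) auto
  have "t < ?\<tau> q \<longleftrightarrow> t < q" for q
    using assms asc by (auto simp: transpose_def)
  then show "left_greater (u \<circ> coxeter_gen i) t = map ?\<tau> (left_greater u t)"
    unfolding left_greater_def inv unfolding comp_gen_eq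
    by (simp add: filter_map o_def)
  have notin: "{u i, u (Suc i)} \<inter> set (filter P (map u js)) = {}"
    if "i \<notin> set js" "Suc i \<notin> set js" for P js
    using that permutes_inj[OF u] by (auto simp: inj_eq)
  from tn show "swappable (u i) (u (Suc i)) (left_greater u t)"
  proof (cases rule: position_cases)
    case 1
    then show ?thesis
      unfolding swappable_def left_greater_def by (intro disjI1 notin) auto
  next
    case 2
    let ?A = "filter ((<) t) (map u [1..<i])" and ?B = "filter ((<) t) (map u [i + 2..<inv u t])"
    have "left_greater u t = ?A @ [u i, u (Suc i)] @ ?B"
      unfolding left_greater_def upt_split[OF 2(1)] using assms asc by simp
    moreover have "{u i, u (Suc i)} \<inter> (set ?A \<union> set ?B) = {}"
      using notin[of "[1..<i]" "(<) t"] notin[of "[i + 2..<inv u t]" "(<) t"] by auto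
    ultimately show ?thesis
      unfolding swappable_def by blast
  qed
qed

text \<open>Multiplying by \<open>s\<^sub>i\<close> moves the entry \<open>u i\<close> to position
  \<open>i + 1\<close>, directly behind the larger entry \<open>u (i + 1)\<close>.\<close>

lemma left_greater_at:
  "left_greater (u \<circ> coxeter_gen i) (u i) = left_greater u (u i) @ [u (Suc i)]"
proof -
  have "map (u \<circ> coxeter_gen i) [1..<i] = map u [1..<i]"
    by (rule map_comp_gen) auto
  then show ?thesis
    using i asc by (simp add: left_greater_def inv_comp_gen del: One_nat_def map_eq_conv)
qed

text \<open>The entry \<open>u i\<close> is smaller than \<open>t\<close> and is filtered out in any
  case, so neither its exchange with \<open>u (i + 1)\<close> nor, for \<open>t = u (i + 1)\<close>,
  its move to the right of \<open>t\<close> is visible.\<close>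

lemma left_greater_above:
  assumes "u i < t"
  shows "left_greater (u \<circ> coxeter_gen i) t = left_greater u t"
proof (cases "t = u (Suc i)")
  case True
  have "map (u \<circ> coxeter_gen i) [1..<i] = map u [1..<i]"
    by (rule map_comp_gen) auto
  then show ?thesis
    using i asc True by (simp add: left_greater_def inv_comp_gen del: One_nat_def map_eq_conv)
next
  case False
  then have "t \<noteq> u i" "t \<noteq> u (Suc i)" using assms by auto
  then show ?thesis
  proof (cases rule: position_cases)
    case 1
    have "map (u \<circ> coxeter_gen i) [1..<inv u t] = map u [1..<inv u t]"
      using 1 by (intro map_comp_gen) auto
    then show ?thesis using 1 by (simp add: left_greater_def del: One_nat_def map_eq_conv)
  next
    case 2
    have "map (u \<circ> coxeter_gen i) [1..<i] = map u [1..<i]"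
      "map (u \<circ> coxeter_gen i) [i+2..<inv u t] = map u [i+2..<inv u t]"
      by (intro map_comp_gen; auto)+
    then show ?thesis
      using assms unfolding left_greater_def 2(2) upt_split[OF 2(1)]
      by (simp del: One_nat_def map_eq_conv)
  qed
qed

section \<open>Comparing the complete sequences of hops for \<open>u s\<^sub>i\<close> and
  \<open>u\<close>\<close>

lemma fold_hops_coupled:
  assumes "coupled (u i) (u (Suc i)) y x" "x permutes {1..n}" "m \<le> u i"
  shows "coupled (u i) (u (Suc i)) (fold (\<lambda>t. hop t (left_greater (u \<circ> coxeter_gen i) t)) [1..<m] y)
      (fold (\<lambda>t. hop t (left_greater u t)) [1..<m] x)
    \<and> fold (\<lambda>t. hop t (left_greater u t)) [1..<m] x permutes {1..n}"
proof -
  define w where "w = u \<circ> coxeter_gen i"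
  show ?thesis
    using assms(3) unfolding w_def[symmetric]
  proof (induction m)
    case 0
    then show ?case using assms by simp
  next
    case (Suc m)
    show ?case
    \<comment> \<open>\<open>[1..<1]\<close> is empty as well: there is no hop with
      \<open>t = 0\<close>.\<close>
    proof (cases "m = 0")
      case True
      then show ?thesis using assms by simp
    next
      case False
      have ab: "u i \<in> {1..n}" "u (Suc i) \<in> {1..n}"
        using permutes_in_image[OF u] i by auto
      then have m: "m \<in> {1..n}" "m < u i" "m < u (Suc i)"
        using False Suc.prems asc by auto
      note sub = left_greater_subset[OF u m(1)]
        and below = left_greater_below[OF m(2), folded w_def]
      define x' y' where "x' = fold (\<lambda>t. hop t (left_greater u t)) [1..<m] x"
        and "y' = fold (\<lambda>t. hop t (left_greater w t)) [1..<m] y"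
      have "coupled (u i) (u (Suc i)) y' x'" "x' permutes {1..n}"
        using Suc by (auto simp: x'_def y'_def)
      then have "coupled (u i) (u (Suc i)) (hop m (left_greater w m) y') (hop m (left_greater u m) x')"
        "hop m (left_greater u m) x' permutes {1..n}"
        unfolding below(1)
        using hop_coupled[OF _ m(1) sub below(2) m(2,3) ab] hop_permutes[OF _ m(1) sub] by blast+
      then show ?thesis
        using False by (simp add: x'_def y'_def)
    qed
  qed
qed

lemma fold_hops_eq:
  assumes "coupled (u i) (u (Suc i)) y x" "x permutes {1..n}"
  shows "fold (\<lambda>t. hop t (left_greater (u \<circ> coxeter_gen i) t)) [1..<n] y =
    fold (\<lambda>t. hop t (left_greater u t)) [1..<n] x"
proof -
  let ?a = "u i" and ?b = "u (Suc i)"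
  let ?F = "\<lambda>t. hop t (left_greater u t)" and ?G = "\<lambda>t. hop t (left_greater (u \<circ> coxeter_gen i) t)"
  have ab: "?a \<in> {1..n}" "?b \<in> {1..n}"
    using permutes_in_image[OF u] i by auto
  \<comment> \<open>From \<open>u i < u (i + 1) \<le> n\<close> it follows that the decisive value
    \<open>u i\<close> lies in \<open>[1..<n]\<close>.\<close>
  have split: "[1..<n] = [1..<?a] @ [?a] @ [Suc ?a..<n]"
    using ab asc upt_add_eq_append[of 1 ?a "n - ?a"] upt_conv_Cons[of ?a n] by simp
  have "?b \<notin> set (left_greater u ?a)"
    using permutes_inj[OF u] by (auto simp: left_greater_def inj_eq)
  then have mid: "?G ?a (fold ?G [1..<?a] y) = ?F ?a (fold ?F [1..<?a] x)"
    using fold_hops_coupled[OF assms order_refl] hop_snoc_coupled left_greater_subset[OF u ab(1)] ab(1) asc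
    unfolding left_greater_at by blast
  have "fold ?G [Suc ?a..<n] z = fold ?F [Suc ?a..<n] z" for z
    by (rule fold_cong) (auto simp: left_greater_above)
  then show ?thesis
    unfolding split using mid by simp
qed

end

section \<open>Coxeter length and reduced words\<close>

lemma coxeter_gen_permutes:
  "i \<in> {1..n - 1} \<Longrightarrow> coxeter_gen i permutes {1..n}"
  unfolding coxeter_gen_def by (rule permutes_swap_id) auto

abbreviation inversions :: "nat \<Rightarrow> (nat \<Rightarrow> nat) \<Rightarrow> (nat \<times> nat) set" where
  "inversions n w \<equiv> {(i, j). 1 \<le> i \<and> i < j \<and> j \<le> n \<and> w j < w i}"

lemma finite_inversions: "finite (inversions n w)"
  by (rule finite_subset[of _ "{1..n} \<times> {1..n}"]) auto

text \<open>Among pairs of positions \<open>j < k\<close>, \<open>s\<^sub>i\<close> reverses only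
  \<open>(i, i + 1)\<close>. Applied to both components, it carries the inversions of
  \<open>u\<close> bijectively to the other inversions of \<open>u s\<^sub>i\<close>.\<close>

lemma coxeter_length_comp_gen:
  assumes i: "i \<in> {1..n - 1}" and asc: "u i < u (Suc i)"
  shows "coxeter_length n (u \<circ> coxeter_gen i) = Suc (coxeter_length n u)"
proof -
  let ?s = "coxeter_gen i"
  have s: "1 \<le> ?s j \<longleftrightarrow> 1 \<le> j" "?s j \<le> n \<longleftrightarrow> j \<le> n" for j
    using i by (auto simp: coxeter_gen_def transpose_def)
  have lt: "j < k \<Longrightarrow> (j, k) \<noteq> (i, Suc i) \<Longrightarrow> ?s j < ?s k" for j k
    by (auto simp: coxeter_gen_def transpose_def)
  have inv: "inversions n (u \<circ> ?s) = insert (i, Suc i) (map_prod ?s ?s ` inversions n u)"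
  proof (intro equalityI subsetI)
    fix p
    assume p: "p \<in> inversions n (u \<circ> ?s)"
    obtain j k where jk: "p = (j, k)" by (cases p)
    show "p \<in> insert (i, Suc i) (map_prod ?s ?s ` inversions n u)"
    proof (cases "p = (i, Suc i)")
      case False
      then have "(?s j, ?s k) \<in> inversions n u"
        using p jk lt[of j k] s by auto
      then show ?thesis
        unfolding jk by (intro insertI2 image_eqI[of _ _ "(?s j, ?s k)"]) auto
    qed simp
  next
    fix p
    assume "p \<in> insert (i, Suc i) (map_prod ?s ?s ` inversions n u)"
    then show "p \<in> inversions n (u \<circ> ?s)"
    proof
      assume "p = (i, Suc i)"
      then show ?thesis using i asc by auto
    next
      assume "p \<in> map_prod ?s ?s ` inversions n u"
      then obtain j k where jk: "p = (?s j, ?s k)" "(j, k) \<in> inversions n u"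
        by auto
      then have "(j, k) \<noteq> (i, Suc i)" using asc by auto
      then show ?thesis using jk lt[of j k] s by auto
    qed
  qed
  have notin: "(i, Suc i) \<notin> map_prod ?s ?s ` inversions n u"
  proof
    assume "(i, Suc i) \<in> map_prod ?s ?s ` inversions n u"
    then obtain j k where "?s j = i" "?s k = Suc i" "j < k"
      unfolding image_iff by force
    then show False by (auto simp: coxeter_gen_def transpose_def split: if_splits)
  qed
  have "inj ?s"
    by (metis coxeter_gen_simps(4) injI)
  then have inj: "inj_on (map_prod ?s ?s) (inversions n u)"
    using prod.inj_map inj_on_subset by blast
  show ?thesis
    unfolding coxeter_length_def inv card_image[OF inj, symmetric]
    by (rule card_insert_disjoint[OF finite_imageI[OF finite_inversions] notin])
qed

lemma coxeter_length_comp_gen_desc: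
  assumes "i \<in> {1..n - 1}" "u (Suc i) < u i"
  shows "coxeter_length n u = Suc (coxeter_length n (u \<circ> coxeter_gen i))"
  using coxeter_length_comp_gen[of i n "u \<circ> coxeter_gen i"] assms by (simp add: o_assoc[symmetric])

text \<open>Left multiplication alters only the relative order of the values \<open>i\<close> and
  \<open>i + 1\<close>, so exactly their pair of positions is added.\<close>

lemma coxeter_length_gen_comp:
  assumes i: "i \<in> {1..n - 1}" and u: "u permutes {1..n}" and less: "inv u i < inv u (Suc i)"
  shows "coxeter_length n (coxeter_gen i \<circ> u) = Suc (coxeter_length n u)"
proof -
  let ?s = "coxeter_gen i" and ?p = "inv u i" and ?q = "inv u (Suc i)"
  have up: "u ?p = i" "u ?q = Suc i"
    using permutes_inverses(1)[OF u] by auto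
  have "i \<in> {1..n}" "Suc i \<in> {1..n}"
    using i by auto
  then have pq: "?p \<in> {1..n}" "?q \<in> {1..n}"
    by (simp_all only: permutes_in_image[OF permutes_inv[OF u]])
  have eq: "u j = i \<longleftrightarrow> j = ?p" "u j = Suc i \<longleftrightarrow> j = ?q" for j
    using permutes_inverses[OF u] by metis+
  have lt: "?s x < ?s y \<longleftrightarrow> x < y \<and> (x, y) \<noteq> (i, Suc i) \<or> (x, y) = (Suc i, i)" for x y
    by (auto simp: coxeter_gen_def transpose_def)
  have inv: "inversions n (?s \<circ> u) = insert (?p, ?q) (inversions n u)"
    using less pq by (auto simp: lt eq up)
  have notin: "(?p, ?q) \<notin> inversions n u"
    by (simp add: up)
  show ?thesis
    unfolding coxeter_length_def inv by (rule card_insert_disjoint[OF finite_inversions notin])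
qed

section \<open>Demazure product with one generator, read off from positions\<close>

lemma demazure_gen_eq:
  assumes i: "i \<in> {1..n - 1}" and u: "u permutes {1..n}"
  shows "demazure_gen n i u = (if inv u i < inv u (Suc i) then coxeter_gen i \<circ> u else u)"
proof (cases "inv u i < inv u (Suc i)")
  case True
  then show ?thesis
    using coxeter_length_gen_comp[OF assms] by (simp add: demazure_gen_def)
next
  case False
  let ?s = "coxeter_gen i"
  have "inv u i \<noteq> inv u (Suc i)"
    using permutes_inj[OF permutes_inv[OF u]] by (simp add: inj_eq)
  moreover have "inv (?s \<circ> u) j = inv u (?s j)" for j
    using inv_transpose_comp[OF u] by (simp add: coxeter_gen_def)
  moreover have su: "?s \<circ> u permutes {1..n}"
    using coxeter_gen_permutes[OF i] u by (rule permutes_compose[rotated])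
  \<comment> \<open>In \<open>s\<^sub>i u\<close> the value \<open>i\<close> precedes
    \<open>i + 1\<close>, so the previous lemma applies to it.\<close>
  ultimately have "coxeter_length n u = Suc (coxeter_length n (?s \<circ> u))"
    using coxeter_length_gen_comp[OF i su] False by (simp add: o_assoc)
  then show ?thesis
    using False by (simp add: demazure_gen_def)
qed

text \<open>This starts the coupling. In \<open>s\<^sub>i \<star> v\<close> the value
  \<open>i + 1\<close> is always left of \<open>i\<close>, hence \<open>u (i + 1)\<close> is left of
  \<open>u i\<close> after multiplying by \<open>u\<close>. The two starting points agree if
  \<open>s\<^sub>i \<star> v = s\<^sub>i v\<close> and differ by the transposition if
  \<open>s\<^sub>i \<star> v = v\<close>.\<close>

lemma coupled_demazure_gen:
  assumes u: "u permutes {1..n}" and i: "i \<in> {1..n - 1}" and asc: "u i < u (Suc i)"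
    and v: "v permutes {1..n}"
  shows "coupled (u i) (u (Suc i)) (u \<circ> coxeter_gen i \<circ> v) (u \<circ> demazure_gen n i v)"
proof -
  have inv: "inv (u \<circ> z) (u j) = inv z j" if "z permutes {1..n}" for z j
    using o_inv_distrib[of u z] permutes_bij[OF u] permutes_bij[OF that] permutes_inverses(2)[OF u]
    by simp
  have sv: "coxeter_gen i \<circ> v permutes {1..n}"
    using coxeter_gen_permutes[OF i] v by (rule permutes_compose[rotated])
  have inv_sv: "inv (coxeter_gen i \<circ> v) j = inv v (coxeter_gen i j)" for j
    using inv_transpose_comp[OF v] by (simp add: coxeter_gen_def)
  have ne: "inv v i \<noteq> inv v (Suc i)"
    using permutes_inj[OF permutes_inv[OF v]] by (simp add: inj_eq)
  show ?thesis
  proof (cases "inv v i < inv v (Suc i)")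
    case True
    then show ?thesis
      by (simp add: demazure_gen_eq[OF i v] coupled_def inv[OF sv] inv_sv o_assoc[symmetric])
  next
    case False
    have "u \<circ> coxeter_gen i = transpose (u i) (u (Suc i)) \<circ> u"
      using comp_gen_eq[OF u _ _ asc] i by auto
    then show ?thesis
      using False ne by (simp add: demazure_gen_eq[OF i v] coupled_def inv[OF v] o_assoc)
  qed
qed

section \<open>Reduced words, taken apart from the right end\<close>

definition word_prod :: "nat list \<Rightarrow> nat \<Rightarrow> nat" where
  "word_prod as = foldr (\<lambda>i u. coxeter_gen i \<circ> u) as id"

lemma word_prod_Nil [simp]: "word_prod [] = id"
  by (simp add: word_prod_def)

lemma word_prod_snoc [simp]: "word_prod (as @ [i]) = word_prod as \<circ> coxeter_gen i"
proof -
  have "foldr (\<lambda>i u. coxeter_gen i \<circ> u) as x = word_prod as \<circ> x" for x :: "nat \<Rightarrow> nat"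
    by (induction as) (simp_all add: word_prod_def o_assoc)
  from this[of "coxeter_gen i"] show ?thesis
    by (subst word_prod_def) simp
qed

lemma word_prod_permutes: "set as \<subseteq> {1..n - 1} \<Longrightarrow> word_prod as permutes {1..n}"
  by (induction as rule: rev_induct)
    (auto intro!: permutes_compose coxeter_gen_permutes permutes_id simp del: One_nat_def)

lemma permutes_asc_or_desc:
  "u permutes S \<Longrightarrow> u i < u (Suc i) \<or> u (Suc i) < u (i::nat)"
  using permutes_inj[of u S] by (metis inj_eq n_not_Suc_n nat_neq_iff)

lemma coxeter_length_id [simp]: "coxeter_length n id = 0"
  by (auto simp: coxeter_length_def card_eq_0_iff)

lemma coxeter_length_word_prod_le:
  "set as \<subseteq> {1..n - 1} \<Longrightarrow> coxeter_length n (word_prod as) \<le> length as"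
proof (induction as rule: rev_induct)
  case Nil
  then show ?case by (simp only: word_prod_Nil coxeter_length_id)
next
  case (snoc i as)
  then have "coxeter_length n (word_prod as \<circ> coxeter_gen i) \<le> Suc (length as)"
    using permutes_asc_or_desc[OF word_prod_permutes, of as n i]
      coxeter_length_comp_gen[of i n "word_prod as"] coxeter_length_comp_gen_desc[of i n "word_prod as"]
    by auto
  then show ?case
    by (simp only: word_prod_snoc length_append_singleton)
qed

text \<open>Were \<open>i\<close> a descent of the product of \<open>as\<close>, then
  \<open>w\<close> would be shorter than that product, whose length is at most
  \<open>length as\<close>; but \<open>w\<close> has length \<open>length as + 1\<close>.\<close>

lemma reduced_word_snocD:
  assumes "reduced_word n w (as @ [i])"
  shows "i \<in> {1..n - 1}" "reduced_word n (word_prod as) as" "word_prod as permutes {1..n}"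
    "word_prod as i < word_prod as (Suc i)" "w = word_prod as \<circ> coxeter_gen i"
proof -
  have *: "set as \<subseteq> {1..n - 1}" "i \<in> {1..n - 1}" "w = word_prod as \<circ> coxeter_gen i"
    "Suc (length as) = coxeter_length n w"
    using assms by (auto simp: reduced_word_def word_prod_def[symmetric])
  show "i \<in> {1..n - 1}" "w = word_prod as \<circ> coxeter_gen i" by fact+
  show perm: "word_prod as permutes {1..n}" using *(1) by (rule word_prod_permutes)
  show asc: "word_prod as i < word_prod as (Suc i)"
    using permutes_asc_or_desc[OF perm, of i] coxeter_length_comp_gen_desc[OF *(2), of "word_prod as"]
      coxeter_length_word_prod_le[OF *(1)] *(3,4) by auto
  show "reduced_word n (word_prod as) as"
    using coxeter_length_comp_gen[OF *(2) asc] * by (simp add: reduced_word_def word_prod_def)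
qed

lemma permutes_ascending_eq_id:
  fixes w :: "nat \<Rightarrow> nat"
  assumes w: "w permutes {1..n}" and asc: "\<And>i. i \<in> {1..n - 1} \<Longrightarrow> w i < w (Suc i)"
  shows "w = id"
proof -
  have "j \<le> n \<longrightarrow> j \<le> w j" for j
  proof (induction j)
    case (Suc j)
    show ?case
    proof (cases "j = 0")
      case True
      then show ?thesis using permutes_in_image[OF w, of 1] by auto
    next
      case False
      have "j < w (Suc j)" if "Suc j \<le> n"
        using asc[of j] Suc False that by force
      then show ?thesis by auto
    qed
  qed simp
  then show ?thesis
    using permutes_natset_ge[OF w] by auto
qed

lemma reduced_word_exists:
  assumes "w permutes {1..n}"
  shows "\<exists>as. reduced_word n w as"
  using assms
proof (induction "coxeter_length n w" arbitrary: w rule: less_induct)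
  case less
  show ?case
  proof (cases "\<exists>i\<in>{1..n - 1}. w (Suc i) < w i")
    case True
    then obtain i where i: "i \<in> {1..n - 1}" "w (Suc i) < w i" by blast
    have len: "coxeter_length n w = Suc (coxeter_length n (w \<circ> coxeter_gen i))"
      using coxeter_length_comp_gen_desc[OF i] .
    moreover have "w \<circ> coxeter_gen i permutes {1..n}"
      using coxeter_gen_permutes[OF i(1)] less.prems by (rule permutes_compose)
    ultimately obtain as where as: "reduced_word n (w \<circ> coxeter_gen i) as"
      using less.hyps by force
    then have "w = word_prod (as @ [i])"
      by (simp add: reduced_word_def word_prod_def[symmetric]) (metis o_assoc coxeter_gen_simps(5) comp_id)
    then have "reduced_word n w (as @ [i])"
      using as len i(1) unfolding reduced_word_def word_prod_def[symmetric] by simp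
    then show ?thesis by blast
  next
    case False
    then have "w = id"
      using permutes_ascending_eq_id[OF less.prems] permutes_asc_or_desc[OF less.prems] by blast
    then have "reduced_word n w []"
      by (simp add: reduced_word_def)
    then show ?thesis by blast
  qed
qed

text \<open>The right-hand side does not mention \<open>as\<close>, so independence of the reduced
  word comes with the formula. The induction varies \<open>v\<close> because the last letter acts
  first: the hypothesis is used for \<open>s\<^sub>i \<star> v\<close>.\<close>

lemma foldr_demazure_gen_eq_hops:
  assumes "reduced_word n w as" "v permutes {1..n}"
  shows "foldr (demazure_gen n) as v = fold (\<lambda>t. hop t (left_greater w t)) [1..<n] (w \<circ> v)"
  using assms
proof (induction as arbitrary: w v rule: rev_induct)
  case Nil
  then have w: "w = id" by (simp add: reduced_word_def)
  have "left_greater w t = []" for t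
    by (auto simp: w left_greater_def filter_empty_conv)
  then have "hop t (left_greater w t) x = x" for t x
    by (simp add: hop_Nil hop_candidates_def)
  then have "fold (\<lambda>t. hop t (left_greater w t)) ts x = x" for ts x
    by (induction ts) simp_all
  moreover have "w \<circ> v = v" by (simp add: w)
  ultimately show ?case by simp
next
  case (snoc i as)
  note red = reduced_word_snocD[OF snoc.prems(1)]
  let ?u = "word_prod as" and ?v = "demazure_gen n i v"
  have v: "?v permutes {1..n}"
    using demazure_gen_eq[OF red(1) snoc.prems(2)] snoc.prems(2)
      permutes_compose[OF snoc.prems(2) coxeter_gen_permutes[OF red(1)]] by simp
  have "foldr (demazure_gen n) (as @ [i]) v = fold (\<lambda>t. hop t (left_greater ?u t)) [1..<n] (?u \<circ> ?v)"
    by (subst snoc.IH[OF red(2) v, symmetric]) simp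
  also have "\<dots> = fold (\<lambda>t. hop t (left_greater w t)) [1..<n] (w \<circ> v)"
    unfolding red(5)
    by (rule fold_hops_eq[OF red(3) _ _ red(4) coupled_demazure_gen[OF red(3,1,4) snoc.prems(2)]
          permutes_compose[OF v red(3)], symmetric]) (use red(1) in auto)
  finally show ?case .
qed

theorem theorem3p1:
  fixes n :: nat and w v :: "nat \<Rightarrow> nat"
  assumes "n \<ge> 2"
    and "w permutes {1..n}"
    and "v permutes {1..n}"
  shows "demazure_product n w v =
         fold (\<lambda>t. hop t (left_greater w t)) [1..<n] (w \<circ> v)"
  unfolding demazure_product_def
  \<comment> \<open>Existence of a reduced word is what makes the described value unique.\<close>
  using reduced_word_exists[OF assms(2)] foldr_demazure_gen_eq_hops[OF _ assms(3)]
  by (intro the_equality) auto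

end
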